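(* Let $A$ be a linear operator on a finite dimensional complex vector space $X$. Then there exist an integer $n\ge 0$, non-negative integers $k_1,\dots,k_n$, complex numbers $\lambda_1,\dots,\lambda_n$ (not necessarily distinct), and a basis $\{\mathbf{x}_i^j : 1\le i\le n,\ 0\le j\le k_i\}$ of $X$ such that $$A\mathbf{x}_i^0=\lambda_i\mathbf{x}_i^0\quad\text{for every } 1\le i\le n,\qquad A\mathbf{x}_i^j=\lambda_i\mathbf{x}_i^j+\mathbf{x}_i^{j-1}\quad\text{for every } 1\le i\le n \text{ and every } 1\le j\le k_i.$$ Moreover, a second linear operator $B$ on $X$ is similar to $A$ if and only if $\dim\big((B-\lambda)^kX\big)=\dim\big((A-\lambda)^kX\big)$ for every eigenvalue $\lambda$ of $A$ and every integer $k\ge 1$.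
   Context: For a linear operator $T$ on $X$ and a complex number $\lambda$, $T-\lambda$ denotes $T-\lambda I$, where $I$ is the identity operator on $X$, and $(T-\lambda)^kX$ denotes the range (image) of the operator $(T-\lambda)^k$. The superscript $j$ in $\mathbf{x}_i^j$ is an index, not a power. Two linear operators $A,B$ on $X$ are similar if there is an invertible linear operator $S$ on $X$ with $B=S^{-1}AS$. The case $X=\{\mathbf{0}\}$ is allowed (with $n=0$ and the empty basis). *)

theory Defs
  imports Complex_Main
begin

text \<open>
  A complex vector space is given by a scalar multiplication
  \<open>scale\<close> on an abelian group type (the library locale \<open>vector_space\<close>); the type is the
  whole space. A one-element type gives the zero space.
\<close>

text \<open>Injectivity is part of the definition: a family with repeated vectors is not a basis.\<close>

definition family_basis ::
  "('f::field \<Rightarrow> 'v::ab_group_add \<Rightarrow> 'v) \<Rightarrow> 'i set \<Rightarrow> ('i \<Rightarrow> 'v) \<Rightarrow> bool" where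
  "family_basis scale I b \<longleftrightarrow>
     inj_on b I \<and> \<not> module.dependent scale (b ` I) \<and> module.span scale (b ` I) = UNIV"

definition is_eigenvalue ::
  "('f::field \<Rightarrow> 'v::ab_group_add \<Rightarrow> 'v) \<Rightarrow> ('v \<Rightarrow> 'v) \<Rightarrow> 'f \<Rightarrow> bool" where
  "is_eigenvalue scale A \<mu> \<longleftrightarrow> (\<exists>v. v \<noteq> 0 \<and> A v = scale \<mu> v)"

definition shifted ::
  "('f::field \<Rightarrow> 'v::ab_group_add \<Rightarrow> 'v) \<Rightarrow> ('v \<Rightarrow> 'v) \<Rightarrow> 'f \<Rightarrow> 'v \<Rightarrow> 'v" where
  "shifted scale A \<mu> = (\<lambda>v. A v - scale \<mu> v)"

definition similar_operators ::
  "('f::field \<Rightarrow> 'v::ab_group_add \<Rightarrow> 'v) \<Rightarrow> ('v \<Rightarrow> 'v) \<Rightarrow> ('v \<Rightarrow> 'v) \<Rightarrow> bool" where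
  "similar_operators scale A B \<longleftrightarrow>
     (\<exists>S. Vector_Spaces.linear scale scale S \<and> bij S \<and> B = inv S \<circ> A \<circ> S)"

end

theory Submission
  imports Defs "HOL-Computational_Algebra.Fundamental_Theorem_Algebra"
begin

text \<open>
  Both halves of the theorem come from one induction on the dimension: if \<open>A\<close> on an invariant
  subspace \<open>V\<close> and \<open>B\<close> on an invariant subspace \<open>V'\<close> of the same dimension have equal ranks
  \<open>dim ((A - \<nu>)\<^sup>m V) = dim ((B - \<nu>)\<^sup>m V')\<close> for all eigenvalues \<open>\<nu>\<close> of \<open>A\<close> on \<open>V\<close>, then they have Jordan
  bases with the same block sizes and the same eigenvalues (\<open>jordan_bases_of_same_shape\<close>). Taking
  \<open>B = A\<close> gives existence. For general \<open>B\<close>, the linear map sending one Jordan basis to the other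
  intertwines the two operators (\<open>jordan_basis_intertwiner\<close>), so they are similar; that similar
  operators have equal ranks is clear.

  The induction step removes one Jordan block from each side. Let \<open>\<alpha>\<close> be an eigenvalue of \<open>A\<close> on
  \<open>V\<close>, let \<open>N = A - \<alpha>\<close>, and let \<open>k\<close> be such that the ranks satisfy
  \<open>dim (N\<^sup>k V) > dim (N\<^sup>k\<^sup>+\<^sup>1 V) = dim (N\<^sup>k\<^sup>+\<^sup>2 V)\<close>. Then \<open>N\<close> has a kernel vector \<open>u = N\<^sup>k x \<noteq> 0\<close> in
  \<open>N\<^sup>k V\<close>, but it is injective on \<open>N\<^sup>k\<^sup>+\<^sup>1 V\<close>, so \<open>u\<close> lies outside \<open>N\<^sup>k\<^sup>+\<^sup>1 V\<close>. Choose a linear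
  functional \<open>f\<close> that vanishes on \<open>N\<^sup>k\<^sup>+\<^sup>1 V\<close> and has \<open>f u = 1\<close>. The span \<open>C\<close> of
  \<open>x, N x, \<dots>, N\<^sup>k x\<close> is a Jordan block, and \<open>W = {v \<in> V. f (N\<^sup>j v) = 0 for all j \<le> k}\<close> is an
  invariant complement of \<open>C\<close> in \<open>V\<close>: invariant because \<open>f\<close> kills \<open>N\<^sup>k\<^sup>+\<^sup>1 V\<close>, complementary because the
  matrix of the values \<open>f (N\<^sup>j (N\<^sup>k\<^sup>-\<^sup>i x))\<close> is triangular with ones on the diagonal
  (\<open>split_off_jordan_block\<close>).

  The number \<open>k\<close> is read off from the ranks, so the same \<open>\<alpha>\<close> and \<open>k\<close> work for \<open>B\<close> on \<open>V'\<close>. The two blocks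
  removed are isomorphic, hence contribute the same amount to every rank, and subtraction shows that
  the complements again satisfy the hypothesis.
\<close>

section \<open>Linear maps on subspaces\<close>

context finite_dimensional_vector_space
begin

interpretation endo: finite_dimensional_vector_space_pair scale Basis scale Basis
  by unfold_locales

interpretation functional: vector_space_pair scale "(*)"
  by unfold_locales (simp_all add: algebra_simps)

abbreviation endomorphism :: "('b \<Rightarrow> 'b) \<Rightarrow> bool"
  where "endomorphism \<equiv> Vector_Spaces.linear scale scale"

abbreviation functional :: "('b \<Rightarrow> 'a) \<Rightarrow> bool"
  where "functional \<equiv> Vector_Spaces.linear scale (*)"

lemma endomorphism_funpow: "endomorphism f \<Longrightarrow> endomorphism (f ^^ m)"
  by (induction m) (simp_all add: linear_id Vector_Spaces.linear_compose)

lemma endomorphism_shifted: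
  assumes "endomorphism A"
  shows "endomorphism (shifted scale A \<nu>)"
  unfolding shifted_def
  by (rule endo.linear_compose_sub[OF assms linear_scale_self])

lemma funpow_invariant: "f ` V \<subseteq> V \<Longrightarrow> v \<in> V \<Longrightarrow> (f ^^ m) v \<in> V"
  by (induction m) auto

lemma funpow_image_subset: "f ` V \<subseteq> V \<Longrightarrow> (f ^^ m) ` V \<subseteq> V"
  by (rule image_subsetI) (rule funpow_invariant)

lemma shifted_invariant:
  assumes "subspace V" "A ` V \<subseteq> V"
  shows "shifted scale A \<nu> ` V \<subseteq> V"
  using assms by (auto simp: shifted_def intro!: subspace_diff subspace_scale)

text \<open>
  If the rank is full, the images of a basis of \<open>U\<close> are as many spanning vectors as the dimension
  of their span, hence distinct and independent.
\<close>

lemma inj_on_subspace_iff_dim_image_eq: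
  assumes f: "endomorphism f" and U: "subspace U"
  shows "inj_on f U \<longleftrightarrow> dim (f ` U) = dim U"
proof
  assume "inj_on f U"
  then show "dim (f ` U) = dim U"
    using endo.dim_image_eq[OF f, of U] U by (simp add: span_eq_iff[THEN iffD2])
next
  assume eq: "dim (f ` U) = dim U"
  obtain B where B: "B \<subseteq> U" "independent B" "U \<subseteq> span B" "card B = dim U"
    using basis_exists by blast
  have fin: "finite B" using B(2) by (rule finiteI_independent)
  have span: "span B = U" using B U by (simp add: span_subspace)
  have dim: "dim (f ` U) = dim (f ` B)"
    using endo.linear_span_image[OF f, of B] span by (metis dim_span)
  have "card (f ` B) \<ge> card B"
    using dim dim_le_card[of "f ` B" "f ` B"] fin eq B(4) by (simp add: span_superset)
  then have card: "card (f ` B) = card B"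
    using card_image_le[OF fin, of f] by simp
  then have "inj_on f B" using fin by (rule eq_card_imp_inj_on[rotated])
  moreover have "independent (f ` B)"
    using card dim eq B(4) fin
    by (intro card_le_dim_spanning[of _ "f ` B"]) (auto simp: span_superset)
  ultimately show "inj_on f U"
    using endo.linear_inj_on_span_independent_image[OF f, of B] span by simp
qed

lemma dim_image_direct_sum:
  assumes f: "endomorphism f" and C: "subspace C" "f ` C \<subseteq> C" and W: "subspace W" "f ` W \<subseteq> W"
    and CW: "C \<inter> W = {0}"
  shows "dim (f ` {c + w | c w. c \<in> C \<and> w \<in> W}) = dim (f ` C) + dim (f ` W)"
proof -
  have "f ` {c + w | c w. c \<in> C \<and> w \<in> W} = {c + w | c w. c \<in> f ` C \<and> w \<in> f ` W}"
    by (force simp: endo.linear_add[OF f] image_iff)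
  moreover have "dim (f ` C \<inter> f ` W) = 0"
    using Int_mono[OF C(2) W(2)] unfolding CW dim_eq_0 .
  ultimately show ?thesis
    using dim_sums_Int[OF endo.linear_subspace_image[OF f C(1)] endo.linear_subspace_image[OF f W(1)]]
    by (simp del: dim_eq_0)
qed

lemma independent_Un_if_spans_disjoint:
  assumes S: "independent S" and T: "independent T" and ST: "span S \<inter> span T = {0}"
  shows "independent (S \<union> T)"
proof -
  have fin: "finite S" "finite T" using S T by (simp_all add: finiteI_independent)
  have "dim (span (S \<union> T)) = dim (span S) + dim (span T)"
    using dim_sums_Int[of "span S" "span T"] ST
    by (simp add: span_Un del: dim_span) 
  then have "dim (S \<union> T) = card S + card T"
    using S T by (simp add: dim_eq_card_independent)
  then have "card (S \<union> T) \<le> dim (S \<union> T)"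
    by (simp add: card_Un_le)
  then show ?thesis
    using fin by (intro card_le_dim_spanning[of _ "S \<union> T"]) (auto simp: span_superset)
qed

text \<open>
  Gaussian elimination: the unitriangular matrix \<open>\<phi> j (g i)\<close> is invertible, so the \<open>g i\<close> are
  independent and their span is complementary to the common kernel of the \<open>\<phi> j\<close>. The induction on
  \<open>m\<close> uses that \<open>\<phi> m\<close> vanishes on the span of the earlier vectors.
\<close>

lemma triangular_dual_family:
  fixes \<phi> :: "nat \<Rightarrow> 'b \<Rightarrow> 'a" and g :: "nat \<Rightarrow> 'b"
  assumes "\<And>j. j < m \<Longrightarrow> functional (\<phi> j)"
    and "\<And>j. j < m \<Longrightarrow> \<phi> j (g j) = 1"
    and "\<And>i j. i < j \<Longrightarrow> j < m \<Longrightarrow> \<phi> j (g i) = 0"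
  shows "inj_on g {..<m} \<and> independent (g ` {..<m})
       \<and> (\<forall>c \<in> span (g ` {..<m}). (\<forall>j<m. \<phi> j c = 0) \<longrightarrow> c = 0)
       \<and> (\<forall>v. \<exists>c \<in> span (g ` {..<m}). \<forall>j<m. \<phi> j (v - c) = 0)"
  using assms
proof (induction m)
  case 0
  then show ?case by (simp add: independent_empty)
next
  case (Suc m)
  let ?S = "span (g ` {..<m})"
  have IH: "inj_on g {..<m}" "independent (g ` {..<m})"
      "\<And>c. c \<in> ?S \<Longrightarrow> \<forall>j<m. \<phi> j c = 0 \<Longrightarrow> c = 0"
      "\<And>v. \<exists>c \<in> ?S. \<forall>j<m. \<phi> j (v - c) = 0"
    using Suc.IH[OF Suc.prems] by simp_all
  have lin: "functional (\<phi> j)" if "j \<le> m" for j using Suc.prems(1) that by simp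
  have one: "\<phi> m (g m) = 1" using Suc.prems(2) by simp
  have zero: "\<phi> m c = 0" if "c \<in> ?S" for c
  proof (rule functional.linear_eq_0_on_span[OF lin _ that])
    show "\<phi> m y = 0" if "y \<in> g ` {..<m}" for y
      using that Suc.prems(3)[of _ m] by auto
  qed simp
  have notin: "g m \<notin> ?S" using zero[of "g m"] one by auto
  have set: "g ` {..<Suc m} = insert (g m) (g ` {..<m})" by (simp add: lessThan_Suc)
  have "g m \<notin> g ` {..<m}" using notin span_base[of "g m" "g ` {..<m}"] by argo
  then have "inj_on g {..<Suc m}" using IH(1) by (simp add: lessThan_Suc)
  moreover have "independent (g ` {..<Suc m})"
    unfolding set using notin IH(2) by (rule independent_insertI)
  moreover have "c = 0" if c: "c \<in> span (g ` {..<Suc m})" "\<forall>j<Suc m. \<phi> j c = 0" for c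
  proof -
    obtain a where a: "c - a *s g m \<in> ?S"
      using c(1) unfolding set span_breakdown_eq by blast
    have "\<phi> m (c - a *s g m) = - a"
      using c(2) one
      by (simp add: functional.linear_diff[OF lin] functional.linear_scale[OF lin])
    then have "a = 0" using zero[OF a] by simp
    then show ?thesis using IH(3)[of c] a c(2) by simp
  qed
  moreover have "\<exists>c \<in> span (g ` {..<Suc m}). \<forall>j<Suc m. \<phi> j (v - c) = 0" for v
  proof -
    define a where "a = \<phi> m v"
    obtain c where c: "c \<in> ?S" "\<forall>j<m. \<phi> j (v - a *s g m - c) = 0"
      using IH(4) by blast
    have "\<phi> m (v - a *s g m - c) = 0"
      using zero[OF c(1)] one
      by (simp add: functional.linear_diff[OF lin] functional.linear_scale[OF lin] a_def)
    then have "\<forall>j<Suc m. \<phi> j (v - (a *s g m + c)) = 0"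
      using c(2) by (auto simp: less_Suc_eq diff_diff_add)
    moreover have "a *s g m + c \<in> span (g ` {..<Suc m})"
      unfolding set span_breakdown_eq using c(1) by (intro exI[of _ a]) simp
    ultimately show ?thesis by blast
  qed
  ultimately show ?case by blast
qed

section \<open>Jordan bases\<close>

abbreviation block_index :: "nat \<Rightarrow> (nat \<Rightarrow> nat) \<Rightarrow> (nat \<times> nat) set"
  where "block_index n k \<equiv> {(i, j). i \<in> {1..n} \<and> j \<in> {0..k i}}"

text \<open>
  The basis spans a subspace \<open>V\<close> rather than the whole space, because the construction splits
  invariant subspaces repeatedly. A single block is the case \<open>n = 1\<close>.
\<close>

definition jordan_basis ::
  "('b \<Rightarrow> 'b) \<Rightarrow> 'b set \<Rightarrow> nat \<Rightarrow> (nat \<Rightarrow> nat) \<Rightarrow> (nat \<Rightarrow> 'a) \<Rightarrow> (nat \<Rightarrow> nat \<Rightarrow> 'b) \<Rightarrow> bool"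
  where "jordan_basis A V n k \<mu> x \<longleftrightarrow>
    inj_on (\<lambda>(i, j). x i j) (block_index n k)
    \<and> independent ((\<lambda>(i, j). x i j) ` block_index n k)
    \<and> span ((\<lambda>(i, j). x i j) ` block_index n k) = V
    \<and> (\<forall>i\<in>{1..n}. A (x i 0) = \<mu> i *s x i 0)
    \<and> (\<forall>i\<in>{1..n}. \<forall>j\<in>{1..k i}. A (x i j) = \<mu> i *s x i j + x i (j - 1))"

lemma jordan_basis_mem:
  "jordan_basis A V n k \<mu> x \<Longrightarrow> i \<in> {1..n} \<Longrightarrow> j \<le> k i \<Longrightarrow> x i j \<in> V"
  by (auto simp: jordan_basis_def intro!: span_base)

lemma jordan_basis_subspace: "jordan_basis A V n k \<mu> x \<Longrightarrow> subspace V"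
  by (auto simp: jordan_basis_def)

lemma jordan_basis_invariant:
  assumes x: "jordan_basis A V n k \<mu> x" and A: "endomorphism A"
  shows "A ` V \<subseteq> V"
proof -
  let ?X = "(\<lambda>(i, j). x i j) ` block_index n k"
  have "A (x i j) \<in> V" if ij: "i \<in> {1..n}" "j \<le> k i" for i j
  proof (cases j)
    case 0
    then show ?thesis
      using x ij jordan_basis_mem[OF x] jordan_basis_subspace[OF x]
      by (simp add: jordan_basis_def subspace_scale)
  next
    case (Suc j')
    then have "A (x i j) = \<mu> i *s x i j + x i j'"
      using x ij by (simp add: jordan_basis_def)
    then show ?thesis
      using ij Suc jordan_basis_mem[OF x] jordan_basis_subspace[OF x]
      by (simp add: subspace_add subspace_scale)
  qed
  then have "span (A ` ?X) \<subseteq> V"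
    using jordan_basis_subspace[OF x] by (intro span_minimal) auto
  then show ?thesis
    using endo.linear_span_image[OF A, of ?X] x by (simp add: jordan_basis_def)
qed

text \<open>
  The action on a Jordan basis depends only on the block sizes and eigenvalues, so matching two
  such bases vector by vector commutes with the operators.
\<close>

lemma jordan_basis_intertwiner:
  assumes A: "endomorphism A" and B: "endomorphism B"
    and x: "jordan_basis A V n k \<mu> x" and y: "jordan_basis B V' n k \<mu> y"
  obtains T where "endomorphism T" "inj_on T V" "T ` V = V'" "\<And>v. v \<in> V \<Longrightarrow> T (A v) = B (T v)"
proof -
  let ?I = "block_index n k"
  let ?x = "\<lambda>(i, j). x i j" and ?y = "\<lambda>(i, j). y i j"
  have inj: "inj_on ?x ?I" "inj_on ?y ?I" and ind: "independent (?x ` ?I)" "independent (?y ` ?I)"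
    and span: "span (?x ` ?I) = V" "span (?y ` ?I) = V'"
    using x y by (simp_all add: jordan_basis_def)
  obtain T where T: "endomorphism T" "\<forall>v \<in> ?x ` ?I. T v = (?y \<circ> the_inv_into ?I ?x) v"
    using endo.linear_independent_extend[OF ind(1)] by blast
  have Tx: "T (?x p) = ?y p" if "p \<in> ?I" for p
    using T(2) that the_inv_into_f_f[OF inj(1) that] by fastforce
  have Tij: "T (x i j) = y i j" if "i \<in> {1..n}" "j \<le> k i" for i j
    using Tx[of "(i, j)"] that by simp
  have img: "T ` ?x ` ?I = ?y ` ?I"
    unfolding image_image using Tx by (intro image_cong) auto
  have "T ` V = V'"
    using endo.linear_span_image[OF T(1), of "?x ` ?I"] img span by simp
  moreover have "inj_on T (?x ` ?I)"
  proof (rule inj_onI)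
    fix a b assume "a \<in> ?x ` ?I" "b \<in> ?x ` ?I" and eq: "T a = T b"
    then obtain p q where p: "p \<in> ?I" "a = ?x p" and q: "q \<in> ?I" "b = ?x q" by blast
    have "?y p = ?y q" using eq Tx[OF p(1)] Tx[OF q(1)] p(2) q(2) by argo
    then have "p = q" by (rule inj_onD[OF inj(2) _ p(1) q(1)])
    then show "a = b" using p(2) q(2) by argo
  qed
  then have "inj_on T V"
    using endo.linear_inj_on_span_independent_image[OF T(1), of "?x ` ?I"] img ind span by simp
  moreover have "T (A v) = B (T v)" if "v \<in> V" for v
  proof -
    have gen: "T (A (x i j)) = B (T (x i j))" if ij: "i \<in> {1..n}" "j \<le> k i" for i j
    proof (cases j)
      case 0
      then show ?thesis
        using x y ij by (simp add: Tij jordan_basis_def endo.linear_scale[OF T(1)])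
    next
      case (Suc j')
      then have "A (x i j) = \<mu> i *s x i j + x i j'" "B (y i j) = \<mu> i *s y i j + y i j'"
        using x y ij by (simp_all add: jordan_basis_def)
      then show ?thesis
        using ij Suc by (simp add: Tij endo.linear_scale[OF T(1)] endo.linear_add[OF T(1)])
    qed
    have "(T \<circ> A) v = (B \<circ> T) v"
    proof (rule endo.linear_eq_on_span[where f = "T \<circ> A" and g = "B \<circ> T" and B = "?x ` ?I"])
      show "endomorphism (T \<circ> A)" using A T(1) by (rule Vector_Spaces.linear_compose)
      show "endomorphism (B \<circ> T)" using T(1) B by (rule Vector_Spaces.linear_compose)
      show "v \<in> span (?x ` ?I)" using that span by simp
      show "(T \<circ> A) w = (B \<circ> T) w" if "w \<in> ?x ` ?I" for w
        using gen that by auto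
    qed
    then show ?thesis by simp
  qed
  ultimately show ?thesis using T(1) that by blast
qed

text \<open>
  The intertwiner carries the image of each power to the corresponding image. For single blocks,
  this shows that the blocks removed from the two sides contribute equally to every rank.
\<close>

lemma jordan_basis_dim_eq:
  assumes A: "endomorphism A" and B: "endomorphism B"
    and x: "jordan_basis A V n k \<mu> x" and y: "jordan_basis B V' n k \<mu> y"
  shows "dim ((shifted scale A \<nu> ^^ m) ` V) = dim ((shifted scale B \<nu> ^^ m) ` V')"
proof -
  let ?N = "shifted scale A \<nu>" and ?M = "shifted scale B \<nu>"
  obtain T where T: "endomorphism T" "inj_on T V" "T ` V = V'"
    and com: "\<And>v. v \<in> V \<Longrightarrow> T (A v) = B (T v)"
    using jordan_basis_intertwiner[OF assms] by blast
  have V: "subspace V" "?N ` V \<subseteq> V"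
    using jordan_basis_subspace[OF x] jordan_basis_invariant[OF x A] by (simp_all add: shifted_invariant)
  have pow: "T ((?N ^^ m) v) = (?M ^^ m) (T v)" if "v \<in> V" for v
  proof (induction m)
    case (Suc m)
    have "(?N ^^ m) v \<in> V" using V(2) that by (rule funpow_invariant)
    then show ?case
      using Suc com by (simp add: shifted_def endo.linear_diff[OF T(1)] endo.linear_scale[OF T(1)])
  qed simp
  have sub: "subspace ((?N ^^ m) ` V)"
    using endo.linear_subspace_image endomorphism_funpow[OF endomorphism_shifted[OF A]] V(1) .
  have "(?N ^^ m) ` V \<subseteq> V" using V(2) by (rule funpow_image_subset)
  then have "inj_on T ((?N ^^ m) ` V)" using T(2) by (rule inj_on_subset[rotated])
  then have "dim ((?N ^^ m) ` V) = dim (T ` (?N ^^ m) ` V)"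
    using inj_on_subspace_iff_dim_image_eq[OF T(1) sub] by simp
  also have "T ` (?N ^^ m) ` V = (?M ^^ m) ` V'"
    unfolding T(3)[symmetric] image_image using pow by (rule image_cong[OF refl])
  finally show ?thesis .
qed

lemma jordan_basis_append_block:
  assumes g: "jordan_basis A C 1 (\<lambda>_. l) (\<lambda>_. \<alpha>) (\<lambda>_. g)" and x: "jordan_basis A W n k \<mu> x"
    and CW: "C \<inter> W = {0}"
  shows "jordan_basis A {c + w | c w. c \<in> C \<and> w \<in> W} (Suc n)
           (k(Suc n := l)) (\<mu>(Suc n := \<alpha>)) (x(Suc n := g))"
proof -
  define I R where "I = block_index n k" and "R = {Suc n} \<times> {0..l}"
  define X H where "X = (\<lambda>(i, j). x i j)" and "H = (\<lambda>(i, j). (x(Suc n := g)) i j)"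
  have K: "block_index (Suc n) (k(Suc n := l)) = I \<union> R"
    by (auto simp: I_def R_def le_Suc_eq)
  have HX: "H p = X p" if "p \<in> I" for p using that by (auto simp: I_def H_def X_def)
  have HI: "H ` I = X ` I" using HX by (rule image_cong[OF refl])
  have HR: "H ` R = g ` {0..l}" unfolding R_def H_def by force
  have "(\<lambda>(i::nat, j). g j) ` block_index 1 (\<lambda>_. l) = g ` {0..l}" by force
  moreover have "inj_on g {0..l}"
    using g by (force simp: jordan_basis_def inj_on_def)
  ultimately have gl: "inj_on g {0..l}" "independent (g ` {0..l})" "span (g ` {0..l}) = C"
    using g by (simp_all add: jordan_basis_def)
  have xl: "inj_on X I" "independent (X ` I)" "span (X ` I) = W"
    using x by (simp_all add: jordan_basis_def X_def I_def)
  have "X ` I \<subseteq> W" "g ` {0..l} \<subseteq> C"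
    using span_superset[of "X ` I"] span_superset[of "g ` {0..l}"] by (simp_all add: gl(3) xl(3))
  then have "X ` I \<inter> g ` {0..l} \<subseteq> {0}" unfolding CW[symmetric] by (subst Int_commute) (rule Int_mono)
  moreover have "0 \<notin> X ` I" using xl(2) dependent_zero[of "X ` I"] by argo
  ultimately have "X ` I \<inter> g ` {0..l} = {}" by (metis IntD1 subset_singletonD singletonI)
  then have "H ` I \<inter> H ` R = {}" by (simp only: HI HR)
  moreover have "inj_on H I" using xl(1) by (simp add: inj_on_def HX)
  moreover have "inj_on H R" using gl(1) by (auto simp: inj_on_def R_def H_def)
  ultimately have inj: "inj_on H (I \<union> R)"
    unfolding inj_on_Un by blast
  have ind: "independent (H ` (I \<union> R))"
    unfolding image_Un HI HR
    by (rule independent_Un_if_spans_disjoint[OF xl(2) gl(2)]) (use CW xl gl in auto)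
  have span: "span (H ` (I \<union> R)) = {c + w | c w. c \<in> C \<and> w \<in> W}"
    unfolding image_Un HI HR Un_commute[of "X ` I"] span_Un gl(3) xl(3) ..
  have old: "A (x i 0) = \<mu> i *s x i 0"
      "j \<in> {1..k i} \<Longrightarrow> A (x i j) = \<mu> i *s x i j + x i (j - 1)" if "i \<in> {1..n}" for i j
    using x that by (simp_all add: jordan_basis_def)
  have new: "A (g 0) = \<alpha> *s g 0"
      "j \<in> {1..l} \<Longrightarrow> A (g j) = \<alpha> *s g j + g (j - 1)" for j
    using g by (simp_all add: jordan_basis_def)
  show ?thesis
    unfolding jordan_basis_def K H_def[symmetric]
  proof (intro conjI ballI inj ind span)
    fix i assume i: "i \<in> {1..Suc n}"
    show "A ((x(Suc n := g)) i 0) = (\<mu>(Suc n := \<alpha>)) i *s (x(Suc n := g)) i 0"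
      using i old(1)[of i] new(1) by (cases "i = Suc n") simp_all
    fix j assume j: "j \<in> {1..(k(Suc n := l)) i}"
    show "A ((x(Suc n := g)) i j)
        = (\<mu>(Suc n := \<alpha>)) i *s (x(Suc n := g)) i j + (x(Suc n := g)) i (j - 1)"
      using i j old(2)[of i j] new(2)[of j] by (cases "i = Suc n") simp_all
  qed
qed

section \<open>Splitting off a Jordan block\<close>

text \<open>
  The two rank conditions say that \<open>N = A - \<alpha>\<close> is injective on \<open>N\<^sup>k\<^sup>+\<^sup>1 V\<close> but not on \<open>N\<^sup>k V\<close>. They
  thus yield a nonzero kernel vector \<open>u = N\<^sup>k x\<close> and a functional with value 1 at \<open>u\<close> that dies on
  \<open>N\<^sup>k\<^sup>+\<^sup>1 V\<close>; its compositions with the powers of \<open>N\<close> cut out the complement.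
\<close>

lemma split_off_jordan_block:
  assumes A: "endomorphism A" and V: "subspace V" "A ` V \<subseteq> V"
    and drop: "dim ((shifted scale A \<alpha> ^^ Suc k) ` V) < dim ((shifted scale A \<alpha> ^^ k) ` V)"
    and stable: "dim ((shifted scale A \<alpha> ^^ Suc (Suc k)) ` V) = dim ((shifted scale A \<alpha> ^^ Suc k) ` V)"
  obtains g C W where "jordan_basis A C 1 (\<lambda>_. k) (\<lambda>_. \<alpha>) (\<lambda>_. g)"
    and "subspace W" "A ` W \<subseteq> W" "C \<inter> W = {0}" "V = {c + w | c w. c \<in> C \<and> w \<in> W}"
proof -
  define N where "N = shifted scale A \<alpha>"
  define U where "U m = (N ^^ m) ` V" for m
  have N: "endomorphism N" unfolding N_def using A by (rule endomorphism_shifted)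
  have Nm: "endomorphism (N ^^ m)" for m using N by (rule endomorphism_funpow)
  have NV: "N ` V \<subseteq> V" unfolding N_def using V by (rule shifted_invariant)
  have AN: "A v = \<alpha> *s v + N v" for v by (simp add: N_def shifted_def)
  have U: "subspace (U m)" for m
    unfolding U_def using endo.linear_subspace_image[OF Nm V(1)] .
  have U_Suc: "U (Suc m) = N ` U m" for m by (simp add: U_def image_comp)
  have "inj_on N (U (Suc k))" "\<not> inj_on N (U k)"
    using drop stable
    unfolding inj_on_subspace_iff_dim_image_eq[OF N U] U_Suc[symmetric]
    unfolding U_def N_def by simp_all
  then have inj: "\<forall>y \<in> U (Suc k). N y = 0 \<longrightarrow> y = 0" and "\<exists>y \<in> U k. N y = 0 \<and> y \<noteq> 0"
    unfolding endo.linear_inj_on_iff_eq_0[OF N U] by metis+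
  then obtain u where u: "u \<in> U k" "u \<noteq> 0" "N u = 0" by metis
  have notin: "u \<notin> U (Suc k)" using u inj by metis
  obtain x where x: "x \<in> V" "(N ^^ k) x = u" using u(1) by (auto simp: U_def)
  obtain B where B: "B \<subseteq> U (Suc k)" "independent B" "U (Suc k) \<subseteq> span B"
    by (rule basis_exists)
  have spanB: "span B = U (Suc k)" using B(1,3) U by (rule span_subspace)
  have indep: "independent (insert u B)"
    using notin B(2) unfolding spanB[symmetric] by (rule independent_insertI)
  obtain f where f: "functional f" "\<forall>b \<in> insert u B. f b = (if b = u then 1 else 0)"
    using functional.linear_independent_extend[OF indep, of "\<lambda>b. if b = u then 1 else 0"]
    by (elim exE conjE)
  have fu: "f u = 1" using f(2) by simp
  have fU: "f y = 0" if "y \<in> U (Suc k)" for y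
  proof (rule functional.linear_eq_0_on_span[OF f(1)])
    show "y \<in> span B" using that spanB by simp
    show "f b = 0" if "b \<in> B" for b using that f(2) B(1) notin by auto
  qed

  \<comment> \<open>The chain is numbered from the kernel upwards, so that \<open>\<phi> j (g i)\<close> is unitriangular.\<close>
  define g where "g j = (N ^^ (k - j)) x" for j
  define \<phi> where "\<phi> j = f \<circ> (N ^^ j)" for j
  define C where "C = span (g ` {..<Suc k})"
  define W where "W = {v \<in> V. \<forall>j<Suc k. \<phi> j v = 0}"
  have \<phi>: "functional (\<phi> j)" for j
    unfolding \<phi>_def using Nm f(1) by (rule Vector_Spaces.linear_compose)
  have Npow: "(N ^^ j) (g i) = (N ^^ (j + (k - i))) x" for i j
    by (simp add: g_def funpow_add)
  have Nx0: "(N ^^ m) x = 0" if "k < m" for m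
  proof -
    have "m = (m - Suc k) + Suc k" using that by simp
    then have "(N ^^ m) x = (N ^^ (m - Suc k)) ((N ^^ Suc k) x)"
      by (metis comp_apply funpow_add)
    also have "(N ^^ Suc k) x = 0" using x(2) u(3) by simp
    finally show ?thesis using endo.linear_0[OF Nm] by simp
  qed
  have diag: "\<phi> j (g j) = 1" if "j < Suc k" for j
    using that x(2) fu by (simp add: \<phi>_def Npow)
  have tri: "\<phi> j (g i) = 0" if "i < j" "j < Suc k" for i j
    using that functional.linear_0[OF f(1)] by (simp add: \<phi>_def Npow Nx0)
  note dual = triangular_dual_family[of "Suc k" \<phi> g, OF \<phi> diag tri, folded C_def]
  have gV: "g j \<in> V" for j unfolding g_def using NV x(1) by (rule funpow_invariant)
  have CV: "C \<subseteq> V" unfolding C_def using gV V(1) by (intro span_minimal) auto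

  have idx: "(\<lambda>(i, j). g j) ` block_index 1 (\<lambda>_. k) = g ` {..<Suc k}" by force
  have "jordan_basis A C 1 (\<lambda>_. k) (\<lambda>_. \<alpha>) (\<lambda>_. g)"
    unfolding jordan_basis_def idx
  proof (intro conjI ballI)
    show "inj_on (\<lambda>(i, j). g j) (block_index 1 (\<lambda>_. k))"
      using dual by (auto simp: inj_on_def less_Suc_eq_le)
    show "A (g 0) = \<alpha> *s g 0"
      using Nx0[of "Suc k"] by (simp add: AN g_def)
    show "A (g j) = \<alpha> *s g j + g (j - 1)" if j: "j \<in> {1..k}" for j
    proof -
      have "N (g j) = (N ^^ Suc (k - j)) x" by (simp add: g_def)
      also have "Suc (k - j) = k - (j - 1)" using j by auto
      finally show ?thesis by (simp add: AN g_def)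
    qed
  qed (use dual in \<open>simp_all add: C_def\<close>)
  moreover have W: "subspace W"
    using V(1) by (auto simp: W_def subspace_def functional.linear_0[OF \<phi>]
        functional.linear_add[OF \<phi>] functional.linear_scale[OF \<phi>])
  moreover have "A ` W \<subseteq> W"
  proof -
    have "N v \<in> W" if v: "v \<in> W" for v
    proof -
      have vV: "v \<in> V" using v by (simp add: W_def)
      have "\<phi> j (N v) = 0" if "j < Suc k" for j
      \<comment> \<open>Applying \<open>N\<close> shifts the conditions defining \<open>W\<close>; the one shifted out of range holds since
          \<open>f\<close> vanishes on \<open>U (Suc k)\<close>.\<close>
      proof (cases "j = k")
        case True
        have "\<phi> k (N v) = f ((N ^^ Suc k) v)" by (simp add: \<phi>_def funpow_swap1)
        then show ?thesis using True fU vV by (simp add: U_def)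
      next
        case False
        have "\<phi> j (N v) = \<phi> (Suc j) v" by (simp add: \<phi>_def funpow_swap1)
        then show ?thesis using v that False by (simp add: W_def)
      qed
      then show ?thesis using vV NV by (auto simp: W_def)
    qed
    then show ?thesis
      using W by (auto simp: AN intro!: subspace_add subspace_scale)
  qed
  moreover have "C \<inter> W = {0}"
  proof -
    have "0 \<in> C \<inter> W" using W by (simp add: C_def span_zero subspace_0)
    then show ?thesis using dual by (auto simp: W_def)
  qed
  moreover have "V = {c + w | c w. c \<in> C \<and> w \<in> W}"
  proof (intro set_eqI iffI)
    fix v assume v: "v \<in> V"
    obtain c where c: "c \<in> C" "\<forall>j<Suc k. \<phi> j (v - c) = 0" using dual by blast
    then have "v - c \<in> W" using v CV V(1) by (auto simp: W_def intro: subspace_diff)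
    moreover have "v = c + (v - c)" by simp
    ultimately show "v \<in> {c + w | c w. c \<in> C \<and> w \<in> W}" using c(1) by blast
  next
    fix v assume "v \<in> {c + w | c w. c \<in> C \<and> w \<in> W}"
    then show "v \<in> V" using CV V(1) by (auto simp: W_def intro: subspace_add)
  qed
  ultimately show ?thesis using that by blast
qed

section \<open>Existence of an eigenvector\<close>

text \<open>
  The vector \<open>p(A) v\<close>, evaluated by Horner's scheme.
\<close>

definition poly_apply :: "('b \<Rightarrow> 'b) \<Rightarrow> 'a poly \<Rightarrow> 'b \<Rightarrow> 'b"
  where "poly_apply A p v = fold_coeffs (\<lambda>a w. a *s v + A w) p 0"

lemma poly_apply_0 [simp]: "poly_apply A 0 v = 0"
  by (simp add: poly_apply_def)

lemma poly_apply_pCons [simp]: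
  "endomorphism A \<Longrightarrow> poly_apply A (pCons a p) v = a *s v + A (poly_apply A p v)"
  by (cases "p = 0 \<and> a = 0") (auto simp: poly_apply_def endo.linear_0)

lemma poly_apply_add:
  assumes A: "endomorphism A"
  shows "poly_apply A (p + q) v = poly_apply A p v + poly_apply A q v"
proof (induction p arbitrary: q)
  case (pCons a p)
  then show ?case
    by (cases q) (simp add: A endo.linear_add[OF A] scale_left_distrib algebra_simps)
qed simp

lemma poly_apply_smult:
  assumes A: "endomorphism A"
  shows "poly_apply A (smult c p) v = c *s poly_apply A p v"
  by (induction p) (simp_all add: A endo.linear_scale[OF A] scale_right_distrib)

lemma poly_apply_monom:
  assumes A: "endomorphism A"
  shows "poly_apply A (monom c i) v = c *s (A ^^ i) v"
  by (induction i) (simp_all add: monom_0 monom_Suc A endo.linear_scale[OF A] endo.linear_0[OF A])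

lemma poly_apply_linear_factor:
  assumes A: "endomorphism A"
  shows "poly_apply A ([:- \<alpha>, 1:] * q) v = shifted scale A \<alpha> (poly_apply A q v)"
proof -
  have "[:- \<alpha>, 1:] * q = smult (- \<alpha>) q + pCons 0 q" by simp
  then show ?thesis
    by (simp only: shifted_def poly_apply_add[OF A] poly_apply_smult[OF A] poly_apply_pCons[OF A])
      simp
qed

lemma poly_apply_mem:
  assumes "endomorphism A" "subspace V" "A ` V \<subseteq> V" "v \<in> V"
  shows "poly_apply A p v \<in> V"
  using assms by (induction p) (auto simp: subspace_0 intro!: subspace_add subspace_scale)

text \<open>
  The iterates of \<open>v\<close> cannot all be independent of their predecessors; the first dependence
  \<open>(A ^^ m) v = p(A) v\<close> with \<open>deg p < m\<close> gives the nonzero polynomial \<open>X\<^sup>m - p\<close>.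
\<close>

lemma annihilating_polynomial_exists:
  assumes A: "endomorphism A"
  obtains p where "p \<noteq> 0" "poly_apply A p v = 0"
proof -
  let ?S = "\<lambda>m. span ((\<lambda>i. (A ^^ i) v) ` {..<m})"
  have "\<exists>m. (A ^^ m) v \<in> ?S m"
  proof (rule ccontr)
    assume "\<nexists>m. (A ^^ m) v \<in> ?S m"
    then have notin: "(A ^^ m) v \<notin> ?S m" for m by simp
    have "independent ((\<lambda>i. (A ^^ i) v) ` {..<m}) \<and> card ((\<lambda>i. (A ^^ i) v) ` {..<m}) = m" for m
    proof (induction m)
      case (Suc m)
      have "(A ^^ m) v \<notin> (\<lambda>i. (A ^^ i) v) ` {..<m}"
        using notin[of m] span_superset by (meson subsetD)
      then show ?case
        using Suc notin[of m] by (simp add: lessThan_Suc independent_insert)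
    qed (simp add: independent_empty)
    from this[of "Suc (dim UNIV)"] show False
      using independent_card_le_dim[OF subset_UNIV] by (metis Suc_n_not_le_n)
  qed
  then obtain m where m: "(A ^^ m) v \<in> ?S m" by blast
  have "\<exists>p. poly_apply A p v = y \<and> (\<forall>i\<ge>m. coeff p i = 0)" if "y \<in> ?S m" for y
    using that
  proof (induction rule: span_induct_alt)
    case base
    show ?case by (rule exI[of _ 0]) simp
  next
    case (step c x y)
    then obtain i p where "i < m" "x = (A ^^ i) v" "poly_apply A p v = y" "\<forall>i\<ge>m. coeff p i = 0"
      by blast
    then show ?case
      by (intro exI[of _ "monom c i + p"]) (simp add: poly_apply_add poly_apply_monom A)
  qed
  then obtain p where p: "poly_apply A p v = (A ^^ m) v" "coeff p m = 0"
    using m by blast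
  show ?thesis
  proof
    have "coeff (monom 1 m + smult (- 1) p) m = 1" using p(2) by simp
    then show "monom 1 m + smult (- 1) p \<noteq> 0" by (metis coeff_0 zero_neq_one)
    show "poly_apply A (monom 1 m + smult (- 1) p) v = 0"
      by (simp only: poly_apply_add[OF A] poly_apply_smult[OF A] poly_apply_monom[OF A] p(1)) simp
  qed
qed

end

section \<open>Simultaneous Jordan bases\<close>

locale algebraically_closed_vector_space = finite_dimensional_vector_space scale Basis
  for scale :: "'f::alg_closed_field \<Rightarrow> 'v::ab_group_add \<Rightarrow> 'v" (infixr \<open>*s\<close> 75)
    and Basis :: "'v set"
begin

interpretation endo: finite_dimensional_vector_space_pair scale Basis scale Basis
  by unfold_locales

text \<open>
  Strip linear factors \<open>X - \<alpha>\<close> from a polynomial annihilating some \<open>v \<noteq> 0\<close>: the last nonzero vector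
  before annihilation is an eigenvector.
\<close>

lemma eigenvector_exists:
  assumes A: "endomorphism A" and V: "subspace V" "A ` V \<subseteq> V" and nz: "V \<noteq> {0}"
  obtains \<alpha> v where "v \<in> V" "v \<noteq> 0" "A v = \<alpha> *s v"
proof -
  have "0 \<in> V" using V(1) by (rule subspace_0)
  then obtain v where v: "v \<in> V" "v \<noteq> 0" using nz by auto
  obtain p where p: "p \<noteq> 0" "poly_apply A p v = 0"
    using A by (rule annihilating_polynomial_exists)
  from p have "\<exists>\<alpha> w. w \<in> V \<and> w \<noteq> 0 \<and> A w = \<alpha> *s w"
  proof (induction "degree p" arbitrary: p rule: less_induct)
    case less
    show ?case
    proof (cases "degree p = 0")
      case True
      then obtain c where "p = [:c:]" by (rule degree_eq_zeroE)
      then show ?thesis using less.prems v(2) A by (simp add: endo.linear_0)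
    next
      case False
      then obtain \<alpha> where "poly p \<alpha> = 0"
        using alg_closed_imp_poly_has_root[of p] by auto
      then obtain q where q: "p = [:- \<alpha>, 1:] * q"
        unfolding poly_eq_0_iff_dvd by (elim dvdE)
      have q0: "q \<noteq> 0" using q less.prems(1) by auto
      show ?thesis
      proof (cases "poly_apply A q v = 0")
        case True
        have "degree p = Suc (degree q)"
          unfolding q using q0 by (subst degree_mult_eq) auto
        then show ?thesis using less.hyps[of q] q0 True by simp
      next
        case False
        have "shifted scale A \<alpha> (poly_apply A q v) = 0"
          using less.prems(2) unfolding q poly_apply_linear_factor[OF A] .
        then have "A (poly_apply A q v) = \<alpha> *s poly_apply A q v"
          by (simp add: shifted_def)
        then show ?thesis using False poly_apply_mem[OF A V v(1)] by blast
      qed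
    qed
  qed
  then show ?thesis using that by auto
qed

text \<open>
  For the least \<open>m\<close> at which the decreasing sequence of ranks stops dropping, \<open>m > 0\<close> by the
  hypothesis, and \<open>k = m - 1\<close>.
\<close>

lemma rank_drops_then_stabilises:
  assumes f: "endomorphism f" and drop: "dim (f ` V) < dim V"
  obtains k where "dim ((f ^^ Suc k) ` V) < dim ((f ^^ k) ` V)"
    and "dim ((f ^^ Suc (Suc k)) ` V) = dim ((f ^^ Suc k) ` V)"
proof -
  let ?r = "\<lambda>m. dim ((f ^^ m) ` V)"
  have r_Suc: "?r (Suc m) \<le> ?r m" for m
    using endo.dim_image_le[OF f, of "(f ^^ m) ` V"] by (simp add: image_comp)
  have "\<exists>m. \<not> ?r (Suc m) < ?r m"
  proof (rule ccontr)
    assume "\<nexists>m. \<not> ?r (Suc m) < ?r m"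
    then have dec: "?r (Suc m) < ?r m" for m by blast
    have "?r m + m \<le> ?r 0" for m
    proof (induction m)
      case (Suc m)
      then show ?case using dec[of m] by linarith
    qed simp
    from this[of "Suc (?r 0)"] show False by linarith
  qed
  define m where "m = (LEAST m. \<not> ?r (Suc m) < ?r m)"
  have m: "\<not> ?r (Suc m) < ?r m"
    unfolding m_def using \<open>\<exists>m. \<not> ?r (Suc m) < ?r m\<close> by (rule LeastI_ex)
  then obtain k where k: "m = Suc k" using drop by (cases m) simp_all
  have "?r (Suc k) < ?r k"
    using not_less_Least[of k "\<lambda>m. \<not> ?r (Suc m) < ?r m"] k unfolding m_def by simp
  moreover have "?r (Suc (Suc k)) = ?r (Suc k)"
    using m r_Suc[of m] unfolding k by linarith
  ultimately show ?thesis by (rule that)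
qed

text \<open>
  Only eigenvalues of \<open>A\<close> enter the hypothesis. That is enough: the eigenvalue for the next block is
  always taken from \<open>A\<close>, and the rank equalities produce a block of \<open>B\<close> for it. When the side of
  \<open>A\<close> is exhausted, equality of dimensions leaves nothing on the side of \<open>B\<close>.
\<close>

lemma jordan_bases_of_same_shape:
  assumes A: "endomorphism A" and B: "endomorphism B"
    and V: "subspace V" "A ` V \<subseteq> V" and V': "subspace V'" "B ` V' \<subseteq> V'"
    and dim: "dim V = dim V'"
    and ranks: "\<And>\<nu> v m. v \<in> V \<Longrightarrow> v \<noteq> 0 \<Longrightarrow> A v = \<nu> *s v \<Longrightarrow>
      dim ((shifted scale A \<nu> ^^ m) ` V) = dim ((shifted scale B \<nu> ^^ m) ` V')"
  shows "\<exists>n k \<mu> x y. jordan_basis A V n k \<mu> x \<and> jordan_basis B V' n k \<mu> y"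
  using V V' dim ranks
proof (induction "dim V" arbitrary: V V' rule: less_induct)
  case less
  note V = less.prems(1,2) and V' = less.prems(3,4) and dim = less.prems(5)
  have ranks: "dim ((shifted scale A \<nu> ^^ m) ` V) = dim ((shifted scale B \<nu> ^^ m) ` V')"
    if "v \<in> V" "v \<noteq> 0" "A v = \<nu> *s v" for \<nu> v m
    using less.prems(6) that .
  show ?case
  proof (cases "V = {0}")
    case True
    then have "dim V = 0" by simp
    then have "V' \<subseteq> {0}" using dim by (metis dim_eq_0)
    then have "V' = {0}" using V'(1) subspace_0[of V'] by auto
    have empty: "jordan_basis D {0} 0 (\<lambda>_. 0) (\<lambda>_. 0) (\<lambda>_ _. 0)" for D
      by (simp add: jordan_basis_def independent_empty)
    show ?thesis
      unfolding \<open>V' = {0}\<close> True using empty by (intro exI conjI)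
  next
    case False
    obtain \<alpha> v where v: "v \<in> V" "v \<noteq> 0" "A v = \<alpha> *s v"
      using A V False by (rule eigenvector_exists)
    define N M where "N = shifted scale A \<alpha>" and "M = shifted scale B \<alpha>"
    have N: "endomorphism N" unfolding N_def using A by (rule endomorphism_shifted)
    have NV: "N ` V \<subseteq> V" unfolding N_def using V by (rule shifted_invariant)
    have "N v = 0" using v(3) by (simp add: N_def shifted_def)
    then have "\<not> inj_on N V"
      using v(1,2) endo.linear_inj_on_iff_eq_0[OF N V(1)] by auto
    then have "dim (N ` V) < dim V"
      using inj_on_subspace_iff_dim_image_eq[OF N V(1)] dim_subset[OF NV] by simp
    then obtain l where drop: "dim ((N ^^ Suc l) ` V) < dim ((N ^^ l) ` V)"
      and stable: "dim ((N ^^ Suc (Suc l)) ` V) = dim ((N ^^ Suc l) ` V)"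
      using rank_drops_then_stabilises[OF N] by metis
    have NM: "dim ((N ^^ m) ` V) = dim ((M ^^ m) ` V')" for m
      unfolding N_def M_def using v by (rule ranks)
    obtain g C W where g: "jordan_basis A C 1 (\<lambda>_. l) (\<lambda>_. \<alpha>) (\<lambda>_. g)"
      and W: "subspace W" "A ` W \<subseteq> W" "C \<inter> W = {0}" "V = {c + w | c w. c \<in> C \<and> w \<in> W}"
      using A V drop[unfolded N_def] stable[unfolded N_def] by (rule split_off_jordan_block)
    obtain h D X where h: "jordan_basis B D 1 (\<lambda>_. l) (\<lambda>_. \<alpha>) (\<lambda>_. h)"
      and X: "subspace X" "B ` X \<subseteq> X" "D \<inter> X = {0}" "V' = {c + w | c w. c \<in> D \<and> w \<in> X}"
      using B V' drop[unfolded NM M_def] stable[unfolded NM M_def] by (rule split_off_jordan_block)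
    have C: "subspace C" "A ` C \<subseteq> C" and D: "subspace D" "B ` D \<subseteq> D"
      using jordan_basis_subspace[OF g] jordan_basis_invariant[OF g A]
        jordan_basis_subspace[OF h] jordan_basis_invariant[OF h B] by simp_all
    have splitV: "dim ((shifted scale A \<nu> ^^ m) ` V)
        = dim ((shifted scale A \<nu> ^^ m) ` C) + dim ((shifted scale A \<nu> ^^ m) ` W)" for \<nu> m
      unfolding W(4)
      using endomorphism_funpow[OF endomorphism_shifted[OF A]]
        C(1) funpow_image_subset[OF shifted_invariant[OF C]]
        W(1) funpow_image_subset[OF shifted_invariant[OF W(1,2)]] W(3)
      by (rule dim_image_direct_sum)
    have splitV': "dim ((shifted scale B \<nu> ^^ m) ` V')
        = dim ((shifted scale B \<nu> ^^ m) ` D) + dim ((shifted scale B \<nu> ^^ m) ` X)" for \<nu> m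
      unfolding X(4)
      using endomorphism_funpow[OF endomorphism_shifted[OF B]]
        D(1) funpow_image_subset[OF shifted_invariant[OF D]]
        X(1) funpow_image_subset[OF shifted_invariant[OF X(1,2)]] X(3)
      by (rule dim_image_direct_sum)
    have CD: "dim ((shifted scale A \<nu> ^^ m) ` C) = dim ((shifted scale B \<nu> ^^ m) ` D)" for \<nu> m
      by (rule jordan_basis_dim_eq[OF A B g h])
    have dimV: "dim V = dim C + dim W" and dimV': "dim V' = dim D + dim X" and "dim C = dim D"
      using splitV[of 0 \<alpha>] splitV'[of 0 \<alpha>] CD[of 0 \<alpha>] by simp_all
    have "g 0 \<in> C" using jordan_basis_mem[OF g, of 1 0] by simp
    moreover have "g 0 \<noteq> 0"
    proof
      assume "g 0 = 0"
      then have "0 \<in> (\<lambda>(i, j). g j) ` block_index 1 (\<lambda>_. l)" by force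
      then show False using g dependent_zero by (simp add: jordan_basis_def)
    qed
    ultimately have "dim C \<noteq> 0" by auto
    then have "dim W < dim V" using dimV by linarith
    moreover have "dim W = dim X" using dim dimV dimV' \<open>dim C = dim D\<close> by simp
    moreover have "dim ((shifted scale A \<nu> ^^ m) ` W) = dim ((shifted scale B \<nu> ^^ m) ` X)"
      if w: "w \<in> W" "w \<noteq> 0" "A w = \<nu> *s w" for \<nu> w m
    proof -
      have "w = 0 + w" by simp
      then have "w \<in> V" unfolding W(4) using w(1) subspace_0[OF C(1)] by blast
      from ranks[OF this w(2,3), of m] show ?thesis
        unfolding splitV splitV' CD by simp
    qed
    ultimately obtain n k \<mu> x y
      where "jordan_basis A W n k \<mu> x" "jordan_basis B X n k \<mu> y"
      using less.hyps[OF _ W(1,2) X(1,2)] by metis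
    then show ?thesis
      using jordan_basis_append_block[OF g _ W(3)] jordan_basis_append_block[OF h _ X(3)]
      unfolding W(4)[symmetric] X(4)[symmetric] by metis
  qed
qed

section \<open>Similarity\<close>

lemma similar_imp_rank_eq:
  assumes A: "endomorphism A" and sim: "similar_operators scale A B"
  shows "dim (range (shifted scale B \<nu> ^^ m)) = dim (range (shifted scale A \<nu> ^^ m))"
proof -
  obtain S where S: "endomorphism S" "bij S" "B = inv S \<circ> A \<circ> S"
    using sim by (auto simp: similar_operators_def)
  have inj: "inj S" and surj: "surj S" using S(2) by (simp_all add: bij_def)
  have SB: "S (B v) = A (S v)" for v
    using surj by (simp add: S(3) surj_f_inv_f)
  have pow: "S ((shifted scale B \<nu> ^^ m) v) = (shifted scale A \<nu> ^^ m) (S v)" for v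
    by (induction m)
      (simp_all add: shifted_def SB endo.linear_diff[OF S(1)] endo.linear_scale[OF S(1)])
  have "range (shifted scale A \<nu> ^^ m) = (shifted scale A \<nu> ^^ m) ` range S"
    using surj by simp
  also have "\<dots> = S ` range (shifted scale B \<nu> ^^ m)"
    unfolding image_image pow ..
  finally show ?thesis
    using endo.dim_image_eq[OF S(1) inj_on_subset[OF inj subset_UNIV]] by simp
qed

lemma similar_if_same_shape:
  assumes A: "endomorphism A" and B: "endomorphism B"
    and "jordan_basis A UNIV n k \<mu> x" "jordan_basis B UNIV n k \<mu> y"
  shows "similar_operators scale A B"
proof -
  obtain S where S: "endomorphism S" "inj S" "surj S" "\<And>v. S (B v) = A (S v)"
    using jordan_basis_intertwiner[OF B A assms(4,3)] by auto
  have "B = inv S \<circ> A \<circ> S"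
    by (simp add: fun_eq_iff S(4)[symmetric] inv_f_f[OF S(2)])
  then show ?thesis
    using S(1-3) unfolding similar_operators_def bij_def by blast
qed

end

theorem mainTheorem1:
  fixes scale :: "complex \<Rightarrow> 'v::ab_group_add \<Rightarrow> 'v"
    and Basis :: "'v set"
    and A :: "'v \<Rightarrow> 'v"
  assumes "finite_dimensional_vector_space scale Basis"
    and "Vector_Spaces.linear scale scale A"
  shows "(\<exists>(n::nat) (k :: nat \<Rightarrow> nat) (\<mu> :: nat \<Rightarrow> complex) (x :: nat \<Rightarrow> nat \<Rightarrow> 'v).
            family_basis scale {(i, j). i \<in> {1..n} \<and> j \<in> {0..k i}} (\<lambda>(i, j). x i j) \<and>
            (\<forall>i\<in>{1..n}. A (x i 0) = scale (\<mu> i) (x i 0)) \<and>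
            (\<forall>i\<in>{1..n}. \<forall>j\<in>{1..k i}. A (x i j) = scale (\<mu> i) (x i j) + x i (j - 1)))
       \<and> (\<forall>B. Vector_Spaces.linear scale scale B \<longrightarrow>
            (similar_operators scale A B \<longleftrightarrow>
              (\<forall>\<nu>. is_eigenvalue scale A \<nu> \<longrightarrow>
                (\<forall>m\<ge>1. vector_space.dim scale (range (shifted scale B \<nu> ^^ m))
                      = vector_space.dim scale (range (shifted scale A \<nu> ^^ m))))))"
proof -
  interpret algebraically_closed_vector_space scale Basis
    using assms(1) by (simp add: algebraically_closed_vector_space_def)
  note A = assms(2)
  have same_shape: "\<exists>n k \<mu> x y. jordan_basis A UNIV n k \<mu> x \<and> jordan_basis B UNIV n k \<mu> y"
    if B: "endomorphism B"
      and ranks: "\<And>\<nu> m. is_eigenvalue scale A \<nu> \<Longrightarrow> 1 \<le> m \<Longrightarrow>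
        dim (range (shifted scale B \<nu> ^^ m)) = dim (range (shifted scale A \<nu> ^^ m))" for B
  proof (rule jordan_bases_of_same_shape[OF A B])
    fix \<nu> v m
    assume "v \<noteq> 0" "A v = scale \<nu> v"
    then have "is_eigenvalue scale A \<nu>" by (auto simp: is_eigenvalue_def)
    then show "dim (range (shifted scale A \<nu> ^^ m)) = dim (range (shifted scale B \<nu> ^^ m))"
      \<comment> \<open>For \<open>m = 0\<close> both ranges are the whole space.\<close>
      using ranks[of \<nu> m] by (cases m) simp_all
  qed simp_all
  obtain n k \<mu> x where "jordan_basis A UNIV n k \<mu> x"
    using same_shape[OF A] by blast
  then have basis: "family_basis scale (block_index n k) (\<lambda>(i, j). x i j) \<and>
      (\<forall>i\<in>{1..n}. A (x i 0) = scale (\<mu> i) (x i 0)) \<and>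
      (\<forall>i\<in>{1..n}. \<forall>j\<in>{1..k i}. A (x i j) = scale (\<mu> i) (x i j) + x i (j - 1))"
    unfolding jordan_basis_def family_basis_def by argo
  have similar_iff: "similar_operators scale A B \<longleftrightarrow>
      (\<forall>\<nu>. is_eigenvalue scale A \<nu> \<longrightarrow>
        (\<forall>m\<ge>1. dim (range (shifted scale B \<nu> ^^ m)) = dim (range (shifted scale A \<nu> ^^ m))))"
    if B: "endomorphism B" for B
    using similar_imp_rank_eq[OF A] similar_if_same_shape[OF A B] same_shape[OF B] by meson
  show ?thesis
  proof (rule conjI[OF _ allI[OF impI]], goal_cases)
    case 1
    show ?case by (intro exI) (rule basis)
  next
    case (2 B)
    then show ?case by (rule similar_iff)
  qed
qed

end
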